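(* Let $p$ be a prime, $R=\mathbb{F}_p[x_1,\dots,x_n]$ with a fixed term order $\prec$, and let $G\subset R$ be a finite set of polynomials. Let $t_1,\dots,t_r$ be monomials of $R$ and let $g_{k_1},\dots,g_{k_r}\in G$. Let $\mathcal{T}=\{m_1\succ m_2\succ\cdots\succ m_N\}$ be a finite set of monomials, listed in descending order, such that $\mathcal{T}\supseteq\bigcup_{i=1}^r \operatorname{supp}(t_i g_{k_i})$. Let $A\in\mathbb{F}_p^{r\times N}$ be the matrix whose entry $A_{i,j}$ is the coefficient of the monomial $m_j$ in the polynomial $t_i g_{k_i}$. Then for every $v\in\mathbb{F}_p^r$, $$v^\top A=0\quad\Longleftrightarrow\quad \sum_{i=1}^r v_i\,(t_i g_{k_i})=0\ \text{ in } R.$$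
   Context: For $f\in R$, $\operatorname{supp}(f)$ denotes the finite set of monomials occurring in $f$ with nonzero coefficient. The elements $t_i g_{k_i}$ are called shifted reducers (repetitions among the $g_{k_i}$ are allowed), $\mathcal{T}$ is called the monomial dictionary, and $A$ is called the sparse Macaulay matrix of the batch. *)

theory Defs
  imports
    "HOL-Library.Poly_Mapping"
    "Jordan_Normal_Form.Matrix"
    "Berlekamp_Zassenhaus.Finite_Field"
begin

text \<open>
  The field with \<open>p\<close> elements is \<^typ>\<open>'p::prime_card mod_ring\<close>, where the class
  \<^class>\<open>prime_card\<close> says that \<open>p = CARD('p)\<close> is a prime.
  A monomial is identified with its exponent vector, so the product of monomials is \<open>+\<close> and
  the monomial 1 is \<open>0\<close>. The types allow infinitely many variables; the sets \<open>monomials n\<close> and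
  \<open>polynomials n\<close> restrict to the variables with indices \<open>1, ..., n\<close>. On \<open>polynomials n\<close>, the ring
  operations are those of the type.
\<close>

type_synonym monomial = "nat \<Rightarrow>\<^sub>0 nat"

type_synonym 'a mpolynomial = "monomial \<Rightarrow>\<^sub>0 'a"

definition monomials :: "nat \<Rightarrow> monomial set" where
  "monomials n = {m. Poly_Mapping.keys m \<subseteq> {1..n}}"

abbreviation supp :: "'a::zero mpolynomial \<Rightarrow> monomial set" where
  "supp f \<equiv> Poly_Mapping.keys f"

abbreviation coefficient :: "'a::zero mpolynomial \<Rightarrow> monomial \<Rightarrow> 'a" where
  "coefficient f m \<equiv> Poly_Mapping.lookup f m"

definition polynomials :: "nat \<Rightarrow> 'a::zero mpolynomial set" where
  "polynomials n = {f. supp f \<subseteq> monomials n}"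

abbreviation const_poly :: "'a::zero \<Rightarrow> 'a mpolynomial" where
  "const_poly c \<equiv> Poly_Mapping.single 0 c"

abbreviation monomial_poly :: "monomial \<Rightarrow> 'a::zero_neq_one mpolynomial" where
  "monomial_poly t \<equiv> Poly_Mapping.single t 1"

text \<open>\<open>prec\<close> is the strict order; it is only constrained on the monomials in \<open>n\<close> variables.\<close>

definition term_order :: "nat \<Rightarrow> (monomial \<Rightarrow> monomial \<Rightarrow> bool) \<Rightarrow> bool" where
  "term_order n prec \<longleftrightarrow>
     irreflp_on (monomials n) prec \<and>
     transp_on (monomials n) prec \<and>
     totalp_on (monomials n) prec \<and>
     (\<forall>a\<in>monomials n. a \<noteq> 0 \<longrightarrow> prec 0 a) \<and>
     (\<forall>a\<in>monomials n. \<forall>b\<in>monomials n. \<forall>c\<in>monomials n. prec a b \<longrightarrow> prec (a + c) (b + c))"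

definition shifted_reducer ::
  "monomial \<Rightarrow> 'a::{semiring_0, zero_neq_one} mpolynomial \<Rightarrow> 'a mpolynomial" where
  "shifted_reducer t g = monomial_poly t * g"

text \<open>
  \<open>ms\<close> lists the monomial dictionary \<open>T\<close> in descending order; in particular the entries of \<open>ms\<close>
  are distinct when \<open>prec\<close> is a strict order on \<open>T\<close>.
\<close>

definition descending_listing ::
  "(monomial \<Rightarrow> monomial \<Rightarrow> bool) \<Rightarrow> monomial set \<Rightarrow> monomial list \<Rightarrow> bool" where
  "descending_listing prec T ms \<longleftrightarrow> set ms = T \<and> sorted_wrt (\<lambda>a b. prec b a) ms"

text \<open>Rows and columns are indexed from 0, as usual for \<^typ>\<open>'a mat\<close>.\<close>

definition sparse_macaulay_matrix ::
  "nat \<Rightarrow> (nat \<Rightarrow> monomial) \<Rightarrow> (nat \<Rightarrow> 'a::{semiring_0, zero_neq_one} mpolynomial) \<Rightarrow>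
   monomial list \<Rightarrow> 'a mat" where
  "sparse_macaulay_matrix r t g ms =
     mat r (length ms) (\<lambda>(i, j). coefficient (shifted_reducer (t i) (g i)) (ms ! j))"

end

theory Submission
  imports Defs
begin

text \<open>
  Entry \<open>j\<close> of \<open>v\<^sup>T A\<close> is the coefficient of \<open>m\<^sub>j\<close> in the linear combination of the
  shifted reducers, and every other coefficient of that combination vanishes since the
  dictionary contains all supports.
\<close>

text \<open>Multiplying by a constant polynomial is the same as mapping the scaling by
  \<open>c\<close> over all coefficients; coefficients that are zero stay zero because
  \<open>c * 0 = 0\<close>.\<close>

lemma lookup_const_poly_mult:
  fixes f :: "'a::semiring_0 mpolynomial"
  shows "coefficient (const_poly c * f) m = c * coefficient f m"
  by (simp flip: mult_map_scale_conv_mult add: map.rep_eq when_def)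

lemma lookup_linear_combination:
  fixes f :: "'i \<Rightarrow> 'a::semiring_0 mpolynomial"
  shows "coefficient (\<Sum>i\<in>I. const_poly (c i) * f i) m = (\<Sum>i\<in>I. c i * coefficient (f i) m)"
  by (simp add: lookup_sum lookup_const_poly_mult)

text \<open>The row-by-column product and the linearity of taking coefficients yield the same sum
  over \<open>i < r\<close>.\<close>

lemma vec_mult_sparse_macaulay_matrix_index:
  assumes "v \<in> carrier_vec r" and "j < length ms"
  shows "(mat_of_row v * sparse_macaulay_matrix r t g ms) $$ (0, j) =
    coefficient (\<Sum>i<r. const_poly (v $ i) * shifted_reducer (t i) (g i)) (ms ! j)"
  using assms
  by (simp add: sparse_macaulay_matrix_def lookup_linear_combination scalar_prod_def
      atLeast0LessThan)

theorem proposition3p2: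
  fixes n r :: nat
    and prec :: "monomial \<Rightarrow> monomial \<Rightarrow> bool"
    and G :: "'p::prime_card mod_ring mpolynomial set"
    and t :: "nat \<Rightarrow> monomial"
    and g :: "nat \<Rightarrow> 'p mod_ring mpolynomial"
    and T :: "monomial set"
    and ms :: "monomial list"
    and A :: "'p mod_ring mat"
  assumes "term_order n prec"
    and "finite G" and "G \<subseteq> polynomials n"
    and "\<And>i. i < r \<Longrightarrow> t i \<in> monomials n"
    and "\<And>i. i < r \<Longrightarrow> g i \<in> G"
    and "finite T" and "T \<subseteq> monomials n"
    and "descending_listing prec T ms"
    and "(\<Union>i<r. supp (shifted_reducer (t i) (g i))) \<subseteq> T"
    and "A = sparse_macaulay_matrix r t g ms"
  shows "\<forall>v \<in> carrier_vec r.
    mat_of_row v * A = 0\<^sub>m 1 (length ms) \<longleftrightarrow>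
    (\<Sum>i<r. const_poly (v $ i) * shifted_reducer (t i) (g i)) = 0"
proof
  fix v :: "'p mod_ring vec"
  assume v: "v \<in> carrier_vec r"
  define h where "h = (\<Sum>i<r. const_poly (v $ i) * shifted_reducer (t i) (g i))"
  have set_ms: "set ms = T"
    using assms(8) by (simp add: descending_listing_def)
  \<comment> \<open>The containment of all supports in \<open>T\<close> enters here: off the
    dictionary, every summand of \<open>h\<close> has coefficient zero.\<close>
  have outside: "coefficient h m = 0" if "m \<notin> set ms" for m
  proof -
    have "coefficient (shifted_reducer (t i) (g i)) m = 0" if "i < r" for i
      using assms(9) \<open>m \<notin> set ms\<close> that set_ms
      by (blast intro: not_in_keys_iff_lookup_eq_zero[THEN iffD1])
    then show ?thesis
      by (simp add: h_def lookup_linear_combination)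
  qed
  \<comment> \<open>Both matrices have the shape 1 by \<open>length ms\<close>, so only the entries
    in row 0 are to be compared.\<close>
  have "mat_of_row v * A = 0\<^sub>m 1 (length ms) \<longleftrightarrow>
      (\<forall>j<length ms. (mat_of_row v * A) $$ (0, j) = 0)"
    by (auto simp: mat_eq_iff assms(10) sparse_macaulay_matrix_def)
  also have "\<dots> \<longleftrightarrow> (\<forall>j<length ms. coefficient h (ms ! j) = 0)"
    using v by (simp add: assms(10) vec_mult_sparse_macaulay_matrix_index h_def)
  also have "\<dots> \<longleftrightarrow> (\<forall>m\<in>set ms. coefficient h m = 0)"
    by (simp add: all_set_conv_all_nth)
  \<comment> \<open>For \<open>h = 0\<close> the coefficients at all monomials of the type must
    vanish, also at those outside \<open>monomials n\<close>; \<open>outside\<close> covers whatever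
    is not listed in \<open>ms\<close>.\<close>
  also have "\<dots> \<longleftrightarrow> h = 0"
    using outside by (auto simp: poly_mapping_eq_iff fun_eq_iff)
  finally show "mat_of_row v * A = 0\<^sub>m 1 (length ms) \<longleftrightarrow>
      (\<Sum>i<r. const_poly (v $ i) * shifted_reducer (t i) (g i)) = 0"
    by (simp add: h_def)
qed

end
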